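(* Let $X \subset \mathbb{R}^n$ be a compact convex set with nonempty interior. If $X$ is of Jensen-type, then the centers of mass of $X$ and of $\partial X$ coincide, i.e. $\frac{1}{|X|}\int_X x\,dx = \frac{1}{|\partial X|}\int_{\partial X} x\,dx$ (as vectors in $\mathbb{R}^n$).
   Context: For a compact convex set $X\subset\mathbb{R}^n$ with nonempty interior, $\partial X$ denotes its boundary, $|X|$ its $n$-dimensional Lebesgue measure and $|\partial X|$ the $(n-1)$-dimensional (surface/Hausdorff) measure of $\partial X$; integrals over $X$ are with respect to Lebesgue measure and integrals over $\partial X$ with respect to surface measure. $X$ is called of Jensen-type if for every convex function $f\colon X\to\mathbb{R}$ (with $f|_{\partial X}$ measurable with respect to completed surface measure, so that the integrals make sense) one has $$\frac{1}{|X|}\int_X f(x)\,dx \le \frac{1}{|\partial X|}\int_{\partial X} f(x)\,dx .$$ A convex function on $X$ is bounded below, so the integrals are well defined in $(-\infty,+\infty]$. The center of mass of $X$ (resp. $\partial X$) is the point whose $i$-th coordinate is the average of the $i$-th coordinate function over $X$ (resp. $\partial X$). *)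

theory Defs
  imports "HOL-Analysis.Analysis"
begin

section \<open>Hausdorff measure\<close>

text \<open>
  The normalising factor makes the \<open>n\<close>-dimensional Hausdorff measure on \<open>n\<close>-dimensional Euclidean
  space agree with Lebesgue measure.  The empty set is treated separately because its diameter is
  \<open>0\<close> and \<open>0 ^ 0 = 1\<close>; with this convention the \<open>0\<close>-dimensional measure is the counting measure.
\<close>

definition hausdorff_weight :: "nat \<Rightarrow> 'a::metric_space set \<Rightarrow> ennreal" where
  "hausdorff_weight s C =
     (if C = {} then 0 else ennreal (unit_ball_vol (real s) * (diameter C / 2) ^ s))"

text \<open>Boundedness is required explicitly since \<^const>\<open>diameter\<close> is unspecified on unbounded sets.\<close>

definition hausdorff_pre :: "nat \<Rightarrow> real \<Rightarrow> 'a::metric_space set \<Rightarrow> ennreal" where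
  "hausdorff_pre s d A =
     (INF C\<in>{C :: nat \<Rightarrow> 'a set. A \<subseteq> (\<Union>i. C i) \<and> (\<forall>i. bounded (C i) \<and> diameter (C i) \<le> d)}.
        \<Sum>i. hausdorff_weight s (C i))"

definition hausdorff_outer :: "nat \<Rightarrow> 'a::metric_space set \<Rightarrow> ennreal" where
  "hausdorff_outer s A = (SUP d\<in>{0<..}. hausdorff_pre s d A)"

definition hausdorff_measure :: "nat \<Rightarrow> 'a::metric_space measure" where
  "hausdorff_measure s = measure_of UNIV (sets borel) (hausdorff_outer s)"

lemma sets_hausdorff_measure [simp, measurable_cong]: "sets (hausdorff_measure s) = sets borel"
  unfolding hausdorff_measure_def using sets.sigma_sets_eq[of borel] by (simp add: sets_measure_of_conv)

lemma space_hausdorff_measure [simp]: "space (hausdorff_measure s) = UNIV"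
  by (simp add: hausdorff_measure_def space_measure_of_conv)

text \<open>
  \<^const>\<open>measure_of\<close> silently returns the null measure if the given set function is not countably
  additive, so we check that the Hausdorff outer measure is countably additive on the Borel sets
  (Caratheodory's criterion for metric outer measures).
\<close>

lemma hausdorff_weight_empty [simp]: "hausdorff_weight s {} = 0"
  by (simp add: hausdorff_weight_def)

lemma hausdorff_pre_le:
  assumes "A \<subseteq> (\<Union>i. C i)" "\<And>i. bounded (C i)" "\<And>i. diameter (C i) \<le> d"
  shows "hausdorff_pre s d A \<le> (\<Sum>i. hausdorff_weight s (C i))"
  unfolding hausdorff_pre_def using assms by (intro INF_lower) auto

lemma hausdorff_pre_empty:
  assumes "0 \<le> d" shows "hausdorff_pre s d ({} :: 'a::metric_space set) = 0"
proof -
  have "hausdorff_pre s d ({} :: 'a set) \<le> (\<Sum>i::nat. hausdorff_weight s ({} :: 'a set))"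
    by (rule hausdorff_pre_le) (auto simp: assms)
  then show ?thesis by simp
qed

lemma hausdorff_pre_mono: "A \<subseteq> B \<Longrightarrow> hausdorff_pre s d A \<le> hausdorff_pre s d B"
  unfolding hausdorff_pre_def by (intro INF_superset_mono) auto

lemma hausdorff_pre_antimono: "d \<le> e \<Longrightarrow> hausdorff_pre s e A \<le> hausdorff_pre s d A"
  unfolding hausdorff_pre_def by (intro INF_superset_mono) (auto intro: order_trans)

lemma hausdorff_pre_countably_subadditive:
  fixes A :: "nat \<Rightarrow> 'a::metric_space set"
  shows "hausdorff_pre s d (\<Union>n. A n) \<le> (\<Sum>n. hausdorff_pre s d (A n))"
proof (rule ennreal_le_epsilon)
  let ?O = "hausdorff_pre s d"
  fix e :: real
  assume e: "0 < e" and fin: "(\<Sum>n. ?O (A n)) < top"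
  then have *: "?O (A n) < ?O (A n) + e * (1/2)^Suc n" for n
    by (auto simp add: less_top dest!: ennreal_suminf_lessD)
  have "\<exists>B. A n \<subseteq> (\<Union>i. B i) \<and> (\<forall>i. bounded (B i) \<and> diameter (B i) \<le> d) \<and>
            (\<Sum>i. hausdorff_weight s (B i)) \<le> ?O (A n) + e * (1/2)^Suc n" for n
    using *[of n] unfolding hausdorff_pre_def[of s d "A n"] INF_less_iff by (auto intro: less_imp_le)
  then obtain B where B: "\<And>n. A n \<subseteq> (\<Union>i. B n i)" "\<And>n i. bounded (B n i)"
      "\<And>n i. diameter (B n i) \<le> d"
      "\<And>n. (\<Sum>i. hausdorff_weight s (B n i)) \<le> ?O (A n) + e * (1/2)^Suc n"
    by metis
  define C where "C = case_prod B o prod_decode"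
  have "(\<Union>n. A n) \<subseteq> (\<Union>i. C i)"
    using B(1) by (auto simp add: C_def subset_eq) (metis prod.case prod_encode_inverse)
  then have "?O (\<Union>n. A n) \<le> (\<Sum>i. hausdorff_weight s (C i))"
    by (rule hausdorff_pre_le) (auto simp: C_def B split: prod.splits)
  also have "\<dots> = (\<Sum>n. \<Sum>i. hausdorff_weight s (B n i))"
    using suminf_ennreal_2dimen[of "\<lambda>n. \<Sum>i. hausdorff_weight s (B n i)"
        "\<lambda>p. hausdorff_weight s (case_prod B p)"] by (simp add: C_def)
  also have "\<dots> \<le> (\<Sum>n. ?O (A n) + e * (1/2) ^ Suc n)"
    by (intro suminf_le allI B) auto
  also have "\<dots> = (\<Sum>n. ?O (A n)) + (\<Sum>n. ennreal e * ennreal ((1/2) ^ Suc n))"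
    using \<open>0 < e\<close> by (subst suminf_add[symmetric])
       (auto simp del: ennreal_suminf_cmult simp add: ennreal_mult[symmetric])
  also have "\<dots> = (\<Sum>n. ?O (A n)) + e"
    unfolding ennreal_suminf_cmult
    by (subst suminf_ennreal_eq[OF zero_le_power power_half_series]) auto
  finally show "?O (\<Union>n. A n) \<le> (\<Sum>n. ?O (A n)) + e" .
qed

lemma hausdorff_outer_empty [simp]: "hausdorff_outer s {} = 0"
  unfolding hausdorff_outer_def by (intro antisym SUP_least) (auto simp: hausdorff_pre_empty)

lemma hausdorff_outer_mono: "A \<subseteq> B \<Longrightarrow> hausdorff_outer s A \<le> hausdorff_outer s B"
  unfolding hausdorff_outer_def by (intro SUP_mono') (auto intro: hausdorff_pre_mono)

lemma hausdorff_pre_le_outer: "0 < d \<Longrightarrow> hausdorff_pre s d A \<le> hausdorff_outer s A"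
  unfolding hausdorff_outer_def by (intro SUP_upper) auto

lemma hausdorff_outer_countably_subadditive:
  fixes A :: "nat \<Rightarrow> 'a::metric_space set"
  shows "hausdorff_outer s (\<Union>n. A n) \<le> (\<Sum>n. hausdorff_outer s (A n))"
  unfolding hausdorff_outer_def[of s "\<Union>n. A n"]
proof (rule SUP_least)
  fix d :: real assume "d \<in> {0<..}"
  then have "(\<Sum>n. hausdorff_pre s d (A n)) \<le> (\<Sum>n. hausdorff_outer s (A n))"
    by (intro suminf_le) (auto intro: hausdorff_pre_le_outer)
  with hausdorff_pre_countably_subadditive[of s d A]
  show "hausdorff_pre s d (\<Union>n. A n) \<le> (\<Sum>n. hausdorff_outer s (A n))" by simp
qed

lemma outer_measure_space_hausdorff_outer: "outer_measure_space (Pow UNIV) (hausdorff_outer s)"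
  unfolding outer_measure_space_def positive_def increasing_def countably_subadditive_def
  by (intro conjI ballI allI impI hausdorff_outer_empty hausdorff_outer_mono
      hausdorff_outer_countably_subadditive)

lemma hausdorff_outer_subadditive:
  "hausdorff_outer s (A \<union> B) \<le> hausdorff_outer s A + hausdorff_outer s B"
proof -
  define C where "C n = (if n = 0 then A else if n = 1 then B else {})" for n :: nat
  have "A \<union> B \<subseteq> (\<Union>n. C n)"
    using UN_upper[of 0 UNIV C] UN_upper[of 1 UNIV C] by (simp add: C_def)
  then have "hausdorff_outer s (A \<union> B) \<le> (\<Sum>n. hausdorff_outer s (C n))"
    using hausdorff_outer_mono hausdorff_outer_countably_subadditive order_trans by blast
  also have "\<dots> = (\<Sum>n\<in>{0, 1}. hausdorff_outer s (C n))"
    by (rule suminf_finite) (auto simp: C_def)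
  also have "\<dots> = hausdorff_outer s A + hausdorff_outer s B" by (simp add: C_def)
  finally show ?thesis .
qed

lemma hausdorff_outer_separated:
  assumes r: "r > 0" and sep: "\<And>x y. x \<in> A \<Longrightarrow> y \<in> B \<Longrightarrow> r \<le> dist x y"
  shows "hausdorff_outer s A + hausdorff_outer s B \<le> hausdorff_outer s (A \<union> B)"
proof -
  have pre: "hausdorff_pre s e A + hausdorff_pre s e B \<le> hausdorff_pre s e (A \<union> B)"
    if e: "e < r" for e
    unfolding hausdorff_pre_def[of s e "A \<union> B"]
  proof (rule INF_greatest)
    fix C assume "C \<in> {C :: nat \<Rightarrow> 'a set. A \<union> B \<subseteq> (\<Union>i. C i) \<and>
        (\<forall>i. bounded (C i) \<and> diameter (C i) \<le> e)}"
    then have C: "A \<subseteq> (\<Union>i. C i)" "B \<subseteq> (\<Union>i. C i)" "\<And>i. bounded (C i)" "\<And>i. diameter (C i) \<le> e"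
      by auto
    define CA where "CA i = (if C i \<inter> A \<noteq> {} then C i else {})" for i
    define CB where "CB i = (if C i \<inter> A \<noteq> {} then {} else C i)" for i
    have e0: "0 \<le> e" using C(3,4)[of 0] diameter_ge_0[of "C 0"] by linarith
    have "A \<subseteq> (\<Union>i. CA i)" using C(1) by (fastforce simp: CA_def)
    then have 1: "hausdorff_pre s e A \<le> (\<Sum>i. hausdorff_weight s (CA i))"
      by (rule hausdorff_pre_le) (auto simp: CA_def C e0)
    have "B \<subseteq> (\<Union>i. CB i)"
    proof
      fix y assume y: "y \<in> B"
      then obtain i where i: "y \<in> C i" using C(2) by auto
      have "C i \<inter> A = {}"
      proof (rule ccontr)
        assume "C i \<inter> A \<noteq> {}"
        then obtain x where x: "x \<in> C i" "x \<in> A" by auto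
        have "dist x y \<le> e" using diameter_bounded_bound[OF C(3) x(1) i] C(4)[of i] by linarith
        with sep[OF x(2) y] e show False by simp
      qed
      with i have "y \<in> CB i" by (simp add: CB_def)
      then show "y \<in> (\<Union>i. CB i)" by blast
    qed
    then have 2: "hausdorff_pre s e B \<le> (\<Sum>i. hausdorff_weight s (CB i))"
      by (rule hausdorff_pre_le) (auto simp: CB_def C e0)
    have "hausdorff_weight s (CA i) + hausdorff_weight s (CB i) = hausdorff_weight s (C i)" for i
      by (simp add: CA_def CB_def)
    with suminf_add[of "\<lambda>i. hausdorff_weight s (CA i)" "\<lambda>i. hausdorff_weight s (CB i)"] add_mono[OF 1 2]
    show "hausdorff_pre s e A + hausdorff_pre s e B \<le> (\<Sum>i. hausdorff_weight s (C i))"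
      by simp
  qed
  have *: "hausdorff_pre s a A + hausdorff_pre s b B \<le> hausdorff_outer s (A \<union> B)"
    if "a > 0" "b > 0" for a b
  proof -
    define e where "e = min (min a b) (r / 2)"
    have e: "0 < e" "e \<le> a" "e \<le> b" "e < r" using that r by (auto simp: e_def)
    have "hausdorff_pre s a A + hausdorff_pre s b B \<le> hausdorff_pre s e A + hausdorff_pre s e B"
      using e by (intro add_mono hausdorff_pre_antimono) auto
    also have "\<dots> \<le> hausdorff_outer s (A \<union> B)"
      using pre[OF e(4)] hausdorff_pre_le_outer[OF e(1), of s "A \<union> B"] by simp
    finally show ?thesis .
  qed
  have ne: "{0<..} \<noteq> ({} :: real set)" by (simp add: greaterThan_non_empty)
  have "hausdorff_pre s a A + hausdorff_outer s B \<le> hausdorff_outer s (A \<union> B)" if "a > 0" for a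
    unfolding hausdorff_outer_def[of s B] ennreal_SUP_add_right[OF ne]
    using *[OF that] by (intro SUP_least) auto
  then show ?thesis
    unfolding hausdorff_outer_def[of s A] ennreal_SUP_add_left[OF ne, symmetric]
    by (intro SUP_least) auto
qed

lemma hausdorff_outer_caratheodory_closed:
  fixes F :: "'a::metric_space set"
  assumes F: "closed F"
  shows "hausdorff_outer s (A \<inter> F) + hausdorff_outer s (A - F) \<le> hausdorff_outer s A"
proof (cases "F = {} \<or> hausdorff_outer s A = top")
  case True then show ?thesis by auto
next
  case False
  then have ne: "F \<noteq> {}" and fin: "hausdorff_outer s A \<noteq> top" by auto
  let ?h = "hausdorff_outer s"
  define E where "E n = {x \<in> A. 1 / real (n + 1) \<le> infdist x F}" for n
  define D where "D n = E (n + 1) - E n" for n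
  have sepE: "?h (A \<inter> F) + ?h (E n) \<le> ?h A" for n
  proof -
    have "?h (A \<inter> F) + ?h (E n) \<le> ?h (A \<inter> F \<union> E n)"
    proof (rule hausdorff_outer_separated[of "1 / real (n + 1)"])
      fix x y assume "x \<in> A \<inter> F" "y \<in> E n"
      then show "1 / real (n + 1) \<le> dist x y"
        using infdist_le[of x F y] by (auto simp: E_def dist_commute intro: order_trans)
    qed simp
    also have "\<dots> \<le> ?h A" by (rule hausdorff_outer_mono) (auto simp: E_def)
    finally show ?thesis .
  qed
  have sepD: "(\<Sum>k<N. ?h (D (2 * k + p))) \<le> ?h (\<Union>k<N. D (2 * k + p))" for N p
  proof (induction N)
    case (Suc N)
    have "?h (\<Union>k<N. D (2 * k + p)) + ?h (D (2 * N + p))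
          \<le> ?h ((\<Union>k<N. D (2 * k + p)) \<union> D (2 * N + p))"
    proof (rule hausdorff_outer_separated[of
          "if N = 0 then 1 else 1 / real (2 * N + p) - 1 / real (2 * N + p + 1)"], goal_cases)
      case 1
      show ?case
      proof (cases "N = 0")
        case False
        then have "1 / real (2 * N + p + 1) < 1 / real (2 * N + p)"
          by (intro divide_strict_left_mono) auto
        with False show ?thesis by simp
      qed simp
    next
      case (2 x y)
      then obtain k where k: "k < N" "x \<in> D (2 * k + p)" by auto
      then have "1 / real (2 * k + p + 2) \<le> infdist x F" by (simp add: D_def E_def algebra_simps)
      moreover have "1 / real (2 * N + p) \<le> 1 / real (2 * k + p + 2)"
        using k by (intro divide_left_mono) auto
      moreover have "infdist y F < 1 / real (2 * N + p + 1)"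
        using 2 by (auto simp: D_def E_def)
      ultimately show ?case using infdist_triangle[of x F y] k by simp
    qed
    also have "(\<Union>k<N. D (2 * k + p)) \<union> D (2 * N + p) = (\<Union>k<Suc N. D (2 * k + p))"
      by (auto simp: less_Suc_eq)
    finally show ?case using Suc by (simp add: add_mono order_trans[OF add_right_mono])
  qed simp
  have "(\<Sum>k<N. ?h (D (2 * k + p))) \<le> ?h A" for N p
    by (rule order_trans[OF sepD hausdorff_outer_mono]) (auto simp: D_def E_def)
  then have "(\<Sum>k<N. ?h (D (2 * k + 0))) + (\<Sum>k<N. ?h (D (2 * k + 1))) \<le> ?h A + ?h A" for N
    by (intro add_mono)
  moreover have "(\<Sum>k<2 * N. ?h (D k)) = (\<Sum>k<N. ?h (D (2 * k + 0))) + (\<Sum>k<N. ?h (D (2 * k + 1)))" for N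
    by (induction N) (auto simp: algebra_simps)
  ultimately have part2: "(\<Sum>k<2 * N. ?h (D k)) \<le> ?h A + ?h A" for N by simp
  have part: "(\<Sum>k<N. ?h (D k)) \<le> ?h A + ?h A" for N
    by (rule order_trans[OF sum_mono2 part2[of N]]) auto
  define S where "S = (\<Sum>k. ?h (D k))"
  have "S \<le> ?h A + ?h A" unfolding S_def by (rule suminf_le_const[OF summableI part])
  with fin have Sfin: "S \<noteq> top" by (auto simp: top_unique)
  have step: "(?h (A \<inter> F) + ?h (A - F)) + (\<Sum>k<n. ?h (D k)) \<le> ?h A + S" for n
  proof -
    have "A - F \<subseteq> E n \<union> (\<Union>k. D (k + n))"
    proof
      fix x assume x: "x \<in> A - F"
      then have "infdist x F > 0"
        using F ne by (metis DiffD2 in_closed_iff_infdist_zero infdist_nonneg less_eq_real_def)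
      then obtain m where m: "1 / real (m + 1) \<le> infdist x F"
        by (metis Suc_eq_plus1 less_imp_le nat_approx_posE)
      define m0 where "m0 = (LEAST m. x \<in> E m)"
      have xm: "x \<in> E m" using m x by (auto simp: E_def)
      have m0: "x \<in> E m0" unfolding m0_def by (rule LeastI[of _ m]) (use xm in auto)
      have mono: "E i \<subseteq> E j" if "i \<le> j" for i j
      proof -
        have "1 / real (j + 1) \<le> 1 / real (i + 1)" using that by (intro divide_left_mono) auto
        then show ?thesis by (auto simp: E_def)
      qed
      show "x \<in> E n \<union> (\<Union>k. D (k + n))"
      proof (cases "m0 \<le> n")
        case True then show ?thesis using mono m0 by blast
      next
        case False
        then obtain k where k: "m0 = k + n + 1" by (metis add.commute less_iff_Suc_add not_le Suc_eq_plus1)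
        have "x \<notin> E (k + n)" using not_less_Least[of "k + n" "\<lambda>m. x \<in> E m"] k by (simp add: m0_def)
        with m0 k have "x \<in> D (k + n)" by (simp add: D_def)
        then show ?thesis by blast
      qed
    qed
    then have "?h (A - F) \<le> ?h (E n) + (\<Sum>k. ?h (D (k + n)))"
      by (rule order_trans[OF hausdorff_outer_mono order_trans[OF hausdorff_outer_subadditive
            add_left_mono[OF hausdorff_outer_countably_subadditive]]])
    then have "(?h (A \<inter> F) + ?h (A - F)) + (\<Sum>k<n. ?h (D k))
        \<le> (?h (A \<inter> F) + (?h (E n) + (\<Sum>k. ?h (D (k + n))))) + (\<Sum>k<n. ?h (D k))"
      by (intro add_mono) auto
    also have "\<dots> = (?h (A \<inter> F) + ?h (E n)) + S"
      unfolding S_def suminf_offset[OF summableI, of "\<lambda>k. ?h (D k)" n] by (simp add: ac_simps)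
    also have "\<dots> \<le> ?h A + S" using sepE by (intro add_mono) auto
    finally show ?thesis .
  qed
  have "(?h (A \<inter> F) + ?h (A - F)) + S = (SUP n. (?h (A \<inter> F) + ?h (A - F)) + (\<Sum>k<n. ?h (D k)))"
    unfolding S_def suminf_eq_SUP by (rule ennreal_SUP_add_right) simp
  also have "\<dots> \<le> ?h A + S" using step by (intro SUP_least)
  finally show ?thesis
    using Sfin by (simp add: add.commute[of _ S] ennreal_add_left_cancel_le)
qed

lemma borel_subset_hausdorff_caratheodory:
  "sets borel \<subseteq> lambda_system UNIV (Pow UNIV) (hausdorff_outer s :: 'a::metric_space set \<Rightarrow> _)"
proof -
  let ?L = "lambda_system UNIV (Pow UNIV) (hausdorff_outer s :: 'a set \<Rightarrow> _)"
  have sa: "sigma_algebra UNIV ?L"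
    using sigma_algebra.caratheodory_lemma[OF sigma_algebra_Pow outer_measure_space_hausdorff_outer]
    unfolding measure_space_def by blast
  have "F \<in> ?L" if "closed F" for F
    unfolding algebra.lambda_system_eq[OF algebra_Pow]
  proof (clarsimp, rule antisym[OF hausdorff_outer_caratheodory_closed[OF that]])
    fix x show "hausdorff_outer s x \<le> hausdorff_outer s (x \<inter> F) + hausdorff_outer s (x - F)"
      using hausdorff_outer_subadditive[of s "x \<inter> F" "x - F"] by (simp add: Int_Diff_Un)
  qed
  then have "sigma_sets UNIV (Collect closed) \<subseteq> ?L"
    by (intro sigma_algebra.sigma_sets_subset[OF sa]) auto
  then show ?thesis by (simp add: borel_eq_closed)
qed

lemma emeasure_hausdorff_measure:
  fixes A :: "'a::metric_space set"
  assumes "A \<in> sets borel"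
  shows "emeasure (hausdorff_measure s) A = hausdorff_outer s A"
proof (rule emeasure_measure_of[OF hausdorff_measure_def])
  let ?L = "lambda_system UNIV (Pow UNIV) (hausdorff_outer s :: 'a set \<Rightarrow> _)"
  have "measure_space UNIV ?L (hausdorff_outer s)"
    by (rule sigma_algebra.caratheodory_lemma[OF sigma_algebra_Pow outer_measure_space_hausdorff_outer])
  then have ca: "countably_additive ?L (hausdorff_outer s)"
    by (simp add: measure_space_def)
  show "countably_additive (sets (hausdorff_measure s)) (hausdorff_outer s :: 'a set \<Rightarrow> _)"
    unfolding countably_additive_def sets_hausdorff_measure
  proof (intro allI impI)
    fix B :: "nat \<Rightarrow> 'a set"
    assume "range B \<subseteq> sets borel" "disjoint_family B" "(\<Union>i. B i) \<in> sets borel"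
    then show "(\<Sum>i. hausdorff_outer s (B i)) = hausdorff_outer s (\<Union>i. B i)"
      using ca borel_subset_hausdorff_caratheodory[of s]
      unfolding countably_additive_def by (meson subset_iff)
  qed
qed (auto simp: assms positive_def)


section \<open>Averages, centers of mass, and Jensen-type sets\<close>

definition surface_measure :: "'a::euclidean_space set \<Rightarrow> 'a measure" where
  "surface_measure X = completion (restrict_space (hausdorff_measure (DIM('a) - 1)) (frontier X))"

text \<open>
  Integral with values in the extended reals.  It is the usual one as soon as one of the positive
  and negative parts has finite integral, in particular for functions bounded below on a finite
  measure space.
\<close>

definition ext_integral :: "'a measure \<Rightarrow> ('a \<Rightarrow> real) \<Rightarrow> ereal" where
  "ext_integral M f =
     enn2ereal (\<integral>\<^sup>+ x. ennreal (f x) \<partial>M) - enn2ereal (\<integral>\<^sup>+ x. ennreal (- f x) \<partial>M)"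

definition ext_average :: "'a measure \<Rightarrow> ('a \<Rightarrow> real) \<Rightarrow> ereal" where
  "ext_average M f = ext_integral M f / enn2ereal (emeasure M (space M))"

definition jensen_type :: "'a::euclidean_space set \<Rightarrow> bool" where
  "jensen_type X \<longleftrightarrow>
     (\<forall>f. convex_on X f \<longrightarrow> f \<in> borel_measurable (surface_measure X) \<longrightarrow>
        ext_average (lebesgue_on X) f \<le> ext_average (surface_measure X) f)"

definition center_of_mass :: "(real ^ 'n) measure \<Rightarrow> real ^ 'n" where
  "center_of_mass M = (\<chi> i. (\<integral> x. x $ i \<partial>M) / measure M (space M))"

end

theory Submission
  imports Defs
begin

text \<open>
  Coordinate functions and their negatives are convex, so for them Jensen's inequality is an
  equality. That the surface measure is finite and nonzero need not be proved geometrically: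
  the extended average of the constant \<open>1\<close> over a measure of total mass \<open>0\<close> or \<open>\<infinity>\<close> takes the
  junk value \<open>0\<close>, so Jensen's inequality for the constant \<open>1\<close> excludes both.
\<close>

text \<open>Integrability makes both the positive and the negative part finite, so the
  \<open>ereal\<close> difference is one of real numbers.\<close>

lemma ext_integral_integrable:
  assumes "integrable M f"
  shows "ext_integral M f = ereal (integral\<^sup>L M f)"
proof -
  have "(\<integral>\<^sup>+ x. ennreal (f x) \<partial>M) < top" "(\<integral>\<^sup>+ x. ennreal (- f x) \<partial>M) < top"
    using integrableD(2)[OF assms] integrableD(3)[OF assms] by (auto simp: top.not_eq_extremum)
  then show ?thesis
    unfolding ext_integral_def real_lebesgue_integral_def[OF assms]
    by (metis enn2ereal_ennreal enn2real_nonneg ennreal_enn2real ereal_minus(1))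
qed

text \<open>Links the extended averages in \<open>jensen_type\<close> to the real quotients in
  \<open>center_of_mass\<close>.\<close>

lemma ext_average_integrable:
  assumes "finite_measure M" "integrable M f" "measure M (space M) \<noteq> 0"
  shows "ext_average M f = ereal (integral\<^sup>L M f / measure M (space M))"
  using assms
  by (simp add: ext_average_def ext_integral_integrable finite_measure.emeasure_eq_measure
      enn2ereal_ennreal)

text \<open>The average is the total mass divided by itself. In \<open>ereal\<close> the inverses of
  0 and infinity are each other and their product is 0, so both degenerate masses yield 0.\<close>

lemma ext_average_one:
  assumes "ext_average M (\<lambda>_. 1) \<noteq> 0"
  shows "finite_measure M" "measure M (space M) \<noteq> 0"
proof -
  have avg: "ext_average M (\<lambda>_. 1) = enn2ereal (emeasure M (space M)) / enn2ereal (emeasure M (space M))"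
    by (simp add: ext_average_def ext_integral_def ennreal_neg zero_ennreal.rep_eq)
  then have "emeasure M (space M) \<noteq> top" "emeasure M (space M) \<noteq> 0"
    using assms by (auto simp: zero_ennreal.rep_eq)
  then show "finite_measure M" "measure M (space M) \<noteq> 0"
    by (auto intro: finite_measureI simp: measure_eq_0_null_sets measure_def enn2real_eq_0_iff)
qed

lemma space_surface_measure [simp]: "space (surface_measure X) = frontier X"
  by (simp add: surface_measure_def space_restrict_space)

text \<open>Restricting to the frontier and completing both preserve measurability, so Borel test
  functions are admissible in \<open>jensen_type\<close>.\<close>

lemma borel_measurable_surface_measure:
  assumes "f \<in> borel_measurable borel"
  shows "f \<in> borel_measurable (surface_measure X)"
  unfolding surface_measure_def
  by (intro measurable_completion measurable_restrict_space1)
    (use assms in \<open>simp cong: measurable_cong_sets\<close>)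

theorem lemma1:
  fixes X :: "(real ^ 'n) set"
  assumes "compact X" and "convex X" and "interior X \<noteq> {}"
    and "jensen_type X"
  shows "center_of_mass (lebesgue_on X) = center_of_mass (surface_measure X)"
proof -
  let ?L = "lebesgue_on X" and ?S = "surface_measure X"
  have X: "X \<in> lmeasurable" using assms(1) by (rule lmeasurable_compact)
  have L: "finite_measure ?L"
    using X by (intro finite_measure_lebesgue_on)
  have spL: "space ?L = X" by (simp add: space_restrict_space)
  \<comment> \<open>A convex set is negligible only if its interior is empty.\<close>
  have "measure lebesgue X \<noteq> 0"
    using assms(2,3) X negligible_convex_interior negligible_iff_measure0 by blast
  then have L0: "measure ?L (space ?L) \<noteq> 0"
    using X by (simp add: spL measure_restrict_space fmeasurableD)
  have jensen: "ext_average ?L f \<le> ext_average ?S f"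
    if "convex_on X f" "f \<in> borel_measurable borel" for f
    using assms(4) that borel_measurable_surface_measure unfolding jensen_type_def by blast
  have "ext_average ?L (\<lambda>_. 1) = 1"
    using L L0 by (simp add: ext_average_integrable finite_measure.integrable_const one_ereal_def)
  \<comment> \<open>Jensen bounds this average below by 1.\<close>
  then have S1: "ext_average ?S (\<lambda>_. 1) \<noteq> 0"
    using jensen[of "\<lambda>_. 1"] assms(2) by (auto simp: convex_on_const)
  note S = ext_average_one(1)[OF S1] and S0 = ext_average_one(2)[OF S1]
  obtain B where B: "\<And>x. x \<in> X \<Longrightarrow> norm x \<le> B"
    using compact_imp_bounded[OF assms(1)] by (auto simp: bounded_iff)
  \<comment> \<open>Lets the bound \<open>B\<close> on \<open>X\<close> serve for the surface
    integrals too.\<close>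
  have front: "frontier X \<subseteq> X"
    using assms(1) by (simp add: compact_imp_closed frontier_subset_closed)
  have int: "integrable ?L (\<lambda>x. x $ i)" "integrable ?S (\<lambda>x. x $ i)" for i
  proof -
    have le: "\<bar>x $ i\<bar> \<le> B" if "x \<in> X" for x
      using B[OF that] component_le_norm_cart[of x i] by linarith
    show "integrable ?L (\<lambda>x. x $ i)"
      by (rule finite_measure.integrable_const_bound[OF L, of _ B])
        (auto intro!: AE_I2 le measurable_restrict_space1 measurable_completion simp: spL)
    show "integrable ?S (\<lambda>x. x $ i)"
      by (rule finite_measure.integrable_const_bound[OF S, of _ B])
        (use front in \<open>auto intro!: AE_I2 le borel_measurable_surface_measure\<close>)
  qed
  have "(\<integral>x. x $ i \<partial>?L) / measure ?L (space ?L) = (\<integral>x. x $ i \<partial>?S) / measure ?S (space ?S)" for i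
  proof (rule antisym)
    have "convex_on X (\<lambda>x. x $ i)" "convex_on X (\<lambda>x. - (x $ i))"
      using assms(2) by (auto simp: convex_on_def algebra_simps)
    then have "ext_average ?L (\<lambda>x. x $ i) \<le> ext_average ?S (\<lambda>x. x $ i)"
      "ext_average ?L (\<lambda>x. - (x $ i)) \<le> ext_average ?S (\<lambda>x. - (x $ i))"
      by (auto intro!: jensen)
    \<comment> \<open>The negated coordinate yields the second inequality, since negation reverses
      the order.\<close>
    then show "(\<integral>x. x $ i \<partial>?L) / measure ?L (space ?L) \<le> (\<integral>x. x $ i \<partial>?S) / measure ?S (space ?S)"
      "(\<integral>x. x $ i \<partial>?S) / measure ?S (space ?S) \<le> (\<integral>x. x $ i \<partial>?L) / measure ?L (space ?L)"
      using int[of i] by (simp_all add: ext_average_integrable[OF L _ L0] ext_average_integrable[OF S _ S0])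
  qed
  then show ?thesis by (simp add: center_of_mass_def)
qed

end
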